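(* Let $G$ and $H$ be finite simple connected graphs. If $G$ and $H$ are both DDR, then the strong product $G\boxtimes H$ is DDR. If $G$ and $H$ are both CDDR, then $G\boxtimes H$ is CDDR. If $G$ and $H$ are both DMR, then $G\boxtimes H$ is DMR.
   Context: All graphs are finite, simple and connected. For a graph $G$, $d(u,v)$ is the distance, $\operatorname{diam}(G)$ the diameter, and $\Gamma_i(u)$ the set of vertices at distance exactly $i$ from $u$. $G$ is DDR (distance degree-regular) if $|\Gamma_i(u)|=|\Gamma_i(v)|$ for all vertices $u,v$ and all $i$. $G$ is CDDR (commutative distance degree-regular) if $|\Gamma_i(u)\cap\Gamma_j(v)|=|\Gamma_i(v)\cap\Gamma_j(u)|$ for all vertices $u,v$ and all $1\le i,j\le\operatorname{diam}(G)$. $G$ is DMR (distance mean-regular) if for all $0\le h,i,j\le\operatorname{diam}(G)$ the average $\frac{1}{|\Gamma_h(u)|}\sum_{v\in\Gamma_h(u)}|\Gamma_i(u)\cap\Gamma_j(v)|$ depends only on $h,i,j$ and not on the vertex $u$. The strong product $G\boxtimes H$ has vertex set $V(G)\times V(H)$, and $(g_1,h_1)\sim(g_2,h_2)$ iff ($g_1\sim g_2$ and $h_1=h_2$) or ($g_1=g_2$ and $h_1\sim h_2$) or ($g_1\sim g_2$ and $h_1\sim h_2$). *)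

theory Defs
  imports "Graph_Theory.Graph_Theory"
begin

text \<open>
  A finite simple graph is a \<open>pair_graph\<close>: finitely many vertices, and a finite symmetric and
  loop-free set of arcs, each undirected edge being represented by its two arcs. Connectedness,
  \<open>connected (with_proj G)\<close>, includes that there is at least one vertex.
\<close>

definition gdist :: "'a pair_pre_digraph \<Rightarrow> 'a \<Rightarrow> 'a \<Rightarrow> nat" where
  "gdist G u v = (LEAST n. \<exists>p. pre_digraph.awalk (with_proj G) u p v \<and> length p = n)"

definition diam :: "'a pair_pre_digraph \<Rightarrow> nat" where
  "diam G = Max {gdist G u v | u v. u \<in> pverts G \<and> v \<in> pverts G}"

definition sphere :: "'a pair_pre_digraph \<Rightarrow> nat \<Rightarrow> 'a \<Rightarrow> 'a set" where
  "sphere G i u = {v \<in> pverts G. gdist G u v = i}"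

definition DDR :: "'a pair_pre_digraph \<Rightarrow> bool" where
  "DDR G \<longleftrightarrow> (\<forall>u\<in>pverts G. \<forall>v\<in>pverts G. \<forall>i. card (sphere G i u) = card (sphere G i v))"

definition CDDR :: "'a pair_pre_digraph \<Rightarrow> bool" where
  "CDDR G \<longleftrightarrow> (\<forall>u\<in>pverts G. \<forall>v\<in>pverts G. \<forall>i\<in>{1..diam G}. \<forall>j\<in>{1..diam G}.
     card (sphere G i u \<inter> sphere G j v) = card (sphere G i v \<inter> sphere G j u))"

definition mean_intersection ::
    "'a pair_pre_digraph \<Rightarrow> nat \<Rightarrow> nat \<Rightarrow> nat \<Rightarrow> 'a \<Rightarrow> real" where
  "mean_intersection G h i j u =
     (\<Sum>v\<in>sphere G h u. real (card (sphere G i u \<inter> sphere G j v))) / real (card (sphere G h u))"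

text \<open>
  The mean over an empty sphere is \<open>0 / 0 = 0\<close> here. This never makes an irregular graph DMR:
  for \<open>i = h\<close> and \<open>j = 0\<close> the mean is 1 at every vertex whose sphere of radius \<open>h\<close> is nonempty,
  so the condition forces these spheres to be nonempty for all \<open>h \<le> diam G\<close>
  (see \<open>DMR_sphere_nonempty\<close> below).
\<close>

definition DMR :: "'a pair_pre_digraph \<Rightarrow> bool" where
  "DMR G \<longleftrightarrow> (\<forall>h\<in>{0..diam G}. \<forall>i\<in>{0..diam G}. \<forall>j\<in>{0..diam G}.
     \<forall>u\<in>pverts G. \<forall>v\<in>pverts G. mean_intersection G h i j u = mean_intersection G h i j v)"

definition strong_product ::
    "'a pair_pre_digraph \<Rightarrow> 'b pair_pre_digraph \<Rightarrow> ('a \<times> 'b) pair_pre_digraph"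
    (infixl \<open>\<boxtimes>\<close> 70) where
  "G \<boxtimes> H = \<lparr> pverts = pverts G \<times> pverts H,
     parcs = {((g1, h1), (g2, h2)) | g1 h1 g2 h2.
       g1 \<in> pverts G \<and> g2 \<in> pverts G \<and> h1 \<in> pverts H \<and> h2 \<in> pverts H \<and>
       ((g1, g2) \<in> parcs G \<and> h1 = h2 \<or>
        g1 = g2 \<and> (h1, h2) \<in> parcs H \<or>
        (g1, g2) \<in> parcs G \<and> (h1, h2) \<in> parcs H)} \<rparr>"


text \<open>\<open>gdist\<close> is the library's weighted distance for unit weights.\<close>

lemma (in pair_wf_digraph) gdist_eq_mu:
  assumes "u \<rightarrow>\<^sup>*\<^bsub>with_proj G\<^esub> v"
  shows "wf_digraph.\<mu> (with_proj G) (\<lambda>_. 1) u v = ereal (real (gdist G u v))"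
proof -
  have cost: "awalk_cost (\<lambda>_. 1) p = real (length p)" for p :: "('a \<times> 'a) list"
    by (induct p) auto
  obtain q where "awalk u q v"
    using assms reachable_awalk by auto
  then have ex: "\<exists>n p. awalk u p v \<and> length p = n" by blast
  obtain p where p: "awalk u p v" "length p = gdist G u v"
    using LeastI_ex[OF ex] unfolding gdist_def by blast
  have le: "gdist G u v \<le> length p'" if "awalk u p' v" for p'
    unfolding gdist_def by (rule Least_le) (use that in blast)
  show ?thesis
    unfolding \<mu>_def cost
  proof (rule antisym)
    show "(INF p\<in>{p. awalk u p v}. ereal (real (length p))) \<le> ereal (real (gdist G u v))"
      using p by (intro INF_lower2[of p]) auto
    show "ereal (real (gdist G u v)) \<le> (INF p\<in>{p. awalk u p v}. ereal (real (length p)))"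
      using le by (intro INF_greatest) auto
  qed
qed

lemma pair_graph_strong_product:
  assumes "pair_graph G" "pair_graph H"
  shows "pair_graph (G \<boxtimes> H)"
proof -
  interpret G: pair_graph G by fact
  interpret H: pair_graph H by fact
  have symG: "(b, a) \<in> parcs G" if "(a, b) \<in> parcs G" for a b
    using G.pair_sym_arcs that by (auto simp: symmetric_def elim: symE)
  have symH: "(b, a) \<in> parcs H" if "(a, b) \<in> parcs H" for a b
    using H.pair_sym_arcs that by (auto simp: symmetric_def elim: symE)
  have sub: "parcs (G \<boxtimes> H) \<subseteq> pverts (G \<boxtimes> H) \<times> pverts (G \<boxtimes> H)"
    by (auto simp: strong_product_def)
  have fin: "finite (pverts (G \<boxtimes> H))"
    by (simp add: strong_product_def G.pair_finite_verts H.pair_finite_verts)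
  show ?thesis
  proof
    show "finite (parcs (G \<boxtimes> H))"
      using sub fin by (meson finite_SigmaI finite_subset)
    show "symmetric (with_proj (G \<boxtimes> H))"
      by (auto simp: symmetric_def strong_product_def intro!: symI dest: symG symH)
    show "fst e \<noteq> snd e" if "e \<in> parcs (G \<boxtimes> H)" for e
      using that G.pair_no_loops[of "(a, a)" for a] H.pair_no_loops[of "(a, a)" for a]
      by (auto simp: strong_product_def)
  qed (use sub fin in auto)
qed

lemma connected_strong_product:
  assumes "pair_graph G" "pair_graph H"
    and "Digraph_Component.connected (with_proj G)" "Digraph_Component.connected (with_proj H)"
  shows "Digraph_Component.connected (with_proj (G \<boxtimes> H))"
proof -
  interpret G: pair_graph G by fact
  interpret H: pair_graph H by fact
  interpret P: pair_graph "G \<boxtimes> H" by (rule pair_graph_strong_product) fact+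
  have G: "pverts G \<noteq> {}" "\<And>u v. u \<in> pverts G \<Longrightarrow> v \<in> pverts G \<Longrightarrow> u \<rightarrow>\<^sup>*\<^bsub>with_proj G\<^esub> v"
    using G.symmetric_connected_imp_strongly_connected[OF G.pair_sym_arcs assms(3)]
    by (auto simp: strongly_connected_def)
  have H: "pverts H \<noteq> {}" "\<And>u v. u \<in> pverts H \<Longrightarrow> v \<in> pverts H \<Longrightarrow> u \<rightarrow>\<^sup>*\<^bsub>with_proj H\<^esub> v"
    using H.symmetric_connected_imp_strongly_connected[OF H.pair_sym_arcs assms(4)]
    by (auto simp: strongly_connected_def)
  have 1: "(a, x) \<rightarrow>\<^sup>*\<^bsub>with_proj (G \<boxtimes> H)\<^esub> (b, x)"
    if "a \<rightarrow>\<^sup>*\<^bsub>with_proj G\<^esub> b" "x \<in> pverts H" for a b x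
    using that(1) unfolding reachable_def
  proof (induct rule: rtrancl_on.induct)
    case (rtrancl_on_refl a)
    then show ?case using that(2) by (auto simp: strong_product_def)
  next
    case (rtrancl_on_into_rtrancl_on a b c)
    then have "((b, x), (c, x)) \<in> parcs (G \<boxtimes> H)"
      using that(2) by (auto simp: strong_product_def dest: G.wellformed')
    moreover from this have "(c, x) \<in> pverts (G \<boxtimes> H)"
      by (simp add: strong_product_def)
    ultimately show ?case
      using rtrancl_on_into_rtrancl_on(2) by (auto intro: rtrancl_on.intros(2))
  qed
  have 2: "(a, x) \<rightarrow>\<^sup>*\<^bsub>with_proj (G \<boxtimes> H)\<^esub> (a, y)"
    if "x \<rightarrow>\<^sup>*\<^bsub>with_proj H\<^esub> y" "a \<in> pverts G" for a x y
    using that(1) unfolding reachable_def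
  proof (induct rule: rtrancl_on.induct)
    case (rtrancl_on_refl x)
    then show ?case using that(2) by (auto simp: strong_product_def)
  next
    case (rtrancl_on_into_rtrancl_on x y z)
    then have "((a, y), (a, z)) \<in> parcs (G \<boxtimes> H)"
      using that(2) by (auto simp: strong_product_def dest: H.wellformed')
    moreover from this have "(a, z) \<in> pverts (G \<boxtimes> H)"
      by (simp add: strong_product_def)
    ultimately show ?case
      using rtrancl_on_into_rtrancl_on(2) by (auto intro: rtrancl_on.intros(2))
  qed
  have reach: "u \<rightarrow>\<^sup>*\<^bsub>with_proj (G \<boxtimes> H)\<^esub> v"
    if "u \<in> pverts (G \<boxtimes> H)" "v \<in> pverts (G \<boxtimes> H)" for u v
  proof -
    obtain a x b y where uv: "u = (a, x)" "v = (b, y)" by (cases u, cases v)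
    with that have *: "a \<in> pverts G" "b \<in> pverts G" "x \<in> pverts H" "y \<in> pverts H"
      by (auto simp: strong_product_def)
    show ?thesis unfolding uv
      using 1[OF G(2)[OF *(1,2)] *(3)] 2[OF H(2)[OF *(3,4)] *(2)] by (rule P.reachable_trans)
  qed
  show ?thesis
    unfolding connected_conv
  proof (intro conjI ballI)
    show "verts (with_proj (G \<boxtimes> H)) \<noteq> {}"
      using G(1) H(1) by (auto simp: strong_product_def)
    show "(u, v) \<in> rtrancl_on (verts (with_proj (G \<boxtimes> H))) ((arcs_ends (with_proj (G \<boxtimes> H)))\<^sup>s)"
      if "u \<in> verts (with_proj (G \<boxtimes> H))" "v \<in> verts (with_proj (G \<boxtimes> H))" for u v
      by (rule rtrancl_on_mono[OF _ subset_refl])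
        (use reach[of u v, unfolded reachable_def] that in \<open>auto simp: symcl_def\<close>)
  qed
qed

lemma DMR_sphere_nonempty:
  assumes "pair_graph G" "Digraph_Component.connected (with_proj G)" "DMR G" "h \<le> diam G" "u \<in> pverts G"
    and "w \<in> pverts G" "sphere G h w \<noteq> {}"
  shows "sphere G h u \<noteq> {}"
proof
  interpret pair_graph G by fact
  assume empty: "sphere G h u = {}"
  have reach: "\<exists>p. awalk a p b" if "a \<in> pverts G" "b \<in> pverts G" for a b
    using symmetric_connected_imp_strongly_connected[OF pair_sym_arcs assms(2)] that
    by (auto simp: strongly_connected_def reachable_awalk)
  have gdist_0: "gdist G a b = 0 \<longleftrightarrow> a = b" if "a \<in> pverts G" "b \<in> pverts G" for a b
  proof
    from that have "\<exists>p. awalk a p b" by (rule reach)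
    then have ex: "\<exists>n p. awalk a p b \<and> length p = n" by blast
    obtain q where q: "awalk a q b" "length q = gdist G a b"
      using LeastI_ex[OF ex] unfolding gdist_def by blast
    show "a = b" if "gdist G a b = 0"
      using q that by (simp add: awalk_Nil_iff)
    show "gdist G a b = 0" if "a = b"
    proof -
      have "awalk a [] b" using \<open>a \<in> pverts G\<close> that by (simp add: awalk_Nil_iff)
      then show ?thesis unfolding gdist_def by (intro Least_eq_0) auto
    qed
  qed
  have "sphere G h w \<inter> sphere G 0 v = {v}" if "v \<in> sphere G h w" for v
    using that gdist_0[of v] by (auto simp: sphere_def)
  moreover have "finite (sphere G h w)"
    using pair_finite_verts by (simp add: sphere_def)
  ultimately have "mean_intersection G h h 0 w = 1"
    using assms(7) by (simp add: mean_intersection_def)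
  moreover have "mean_intersection G h h 0 u = 0"
    using empty by (simp add: mean_intersection_def)
  moreover have "mean_intersection G h h 0 u = mean_intersection G h h 0 w"
    using assms(3-6) unfolding DMR_def by (meson atLeastAtMost_iff le0)
  ultimately show False by simp
qed

end

theory Submission
  imports Defs
begin

text \<open>
  Let \<open>R\<close> be the relation "equal or adjacent" on the vertices of a graph; then \<open>d(u,v) \<le> n\<close> holds
  exactly when \<open>(u,v)\<close> lies in the \<open>n\<close>-th power of \<open>R\<close>. The strong product is made so that its
  relation \<open>R\<close> is the componentwise product of those of the factors. Its powers are therefore
  componentwise as well, and \<open>d((a,x), (b,y)) = max (d(a,b)) (d(x,y))\<close>
  (\<open>gdist_strong_product\<close>). Hence the sphere of radius \<open>h\<close> around \<open>(a,x)\<close> is the disjoint union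
  of the rectangles \<open>\<Gamma>\<^sub>p(a) \<times> \<Gamma>\<^sub>q(x)\<close> over the pairs with \<open>max p q = h\<close>.

  It follows that each of the relevant numbers of the strong product is a finite sum, over index
  sets that do not mention the vertices, of a number for \<open>G\<close> times the same kind of number for
  \<open>H\<close>: the sphere sizes, the sizes of \<open>\<Gamma>\<^sub>i(u) \<inter> \<Gamma>\<^sub>j(v)\<close>, and the number of pairs \<open>(v,w)\<close> with
  prescribed distances \<open>d(u,v)\<close>, \<open>d(u,w)\<close>, \<open>d(v,w)\<close>. Invariance of the summands under a change of
  the vertex (or under exchanging \<open>u\<close> and \<open>v\<close>) passes to the sum.

  The radii \<open>p, q\<close> in these sums may be \<open>0\<close>, which the definition of CDDR leaves out, or
  exceed the diameter of one factor, so the hypotheses on the factors are first extended to all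
  radii (\<open>CDDR_all_radii\<close>, \<open>DMR_imp_triangle_count_eq\<close>). Means are not additive over the
  rectangles but counts are. For DMR one may pass from means to counts and back, because a DMR
  graph is DDR: the denominators do not depend on the vertex.
\<close>

section \<open>Distances and spheres in a connected graph\<close>

locale connected_pair_graph = pair_graph +
  assumes connected: "Digraph_Component.connected (with_proj G)"

text \<open>
  Allowing a step to stay in place turns "at most \<open>n\<close> steps" into "exactly \<open>n\<close> steps", so that
  two walks of different lengths can be run in parallel.
\<close>

definition lazy_step :: "'a pair_pre_digraph \<Rightarrow> 'a rel" where
  "lazy_step G = Id_on (pverts G) \<union> parcs G"

context connected_pair_graph
begin

lemma obtain_shortest_awalk:
  assumes "u \<in> pverts G" "v \<in> pverts G"
  obtains p where "awalk u p v" "length p = gdist G u v"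
proof -
  have "\<exists>p. awalk u p v"
    using symmetric_connected_imp_strongly_connected[OF pair_sym_arcs connected] assms
    by (auto simp: strongly_connected_def reachable_awalk)
  then have "\<exists>n p. awalk u p v \<and> length p = n" by blast
  from LeastI_ex[OF this] show thesis
    unfolding gdist_def[symmetric] using that by blast
qed

lemma gdist_le_length: "awalk u p v \<Longrightarrow> gdist G u v \<le> length p"
  unfolding gdist_def by (rule Least_le) blast

lemma awalk_imp_lazy_relpow:
  "awalk u p v \<Longrightarrow> length p \<le> n \<Longrightarrow> (u, v) \<in> lazy_step G ^^ n"
proof (induction n arbitrary: u p)
  case 0
  then show ?case by (simp add: awalk_Nil_iff)
next
  case (Suc n)
  show ?case
  proof (cases p)
    case Nil
    with Suc.prems have "(u, u) \<in> lazy_step G"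
      by (auto simp: lazy_step_def awalk_Nil_iff)
    moreover from Nil Suc have "(u, v) \<in> lazy_step G ^^ n"
      by simp
    ultimately show ?thesis by (rule relpow_Suc_I2)
  next
    case (Cons e es)
    with Suc.prems have "(u, snd e) \<in> lazy_step G" "awalk (snd e) es v" "length es \<le> n"
      by (auto simp: lazy_step_def awalk_Cons_iff)
    with Suc.IH show ?thesis by (blast intro: relpow_Suc_I2)
  qed
qed

lemma lazy_relpow_imp_awalk:
  "(u, v) \<in> lazy_step G ^^ n \<Longrightarrow> u \<in> pverts G \<Longrightarrow> \<exists>p. awalk u p v \<and> length p \<le> n"
proof (induction n arbitrary: u)
  case 0
  then have "awalk u [] v" by (simp add: awalk_Nil_iff)
  then show ?case by auto
next
  case (Suc n)
  from Suc.prems(1) obtain w where w: "(u, w) \<in> lazy_step G" "(w, v) \<in> lazy_step G ^^ n"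
    by (metis relpow_Suc_D2)
  then have "w \<in> pverts G" by (auto simp: lazy_step_def dest: wellformed')
  with Suc.IH w(2) obtain p where p: "awalk w p v" "length p \<le> n" by blast
  from w(1) consider "w = u" | "(u, w) \<in> parcs G" by (auto simp: lazy_step_def)
  then show ?case
  proof cases
    case 1
    with p show ?thesis by (meson le_Suc_eq)
  next
    case 2
    with p have "awalk u ((u, w) # p) v" "length ((u, w) # p) \<le> Suc n"
      by (auto simp: awalk_Cons_iff)
    then show ?thesis by blast
  qed
qed

lemma gdist_le_iff_relpow:
  assumes "u \<in> pverts G" "v \<in> pverts G"
  shows "gdist G u v \<le> n \<longleftrightarrow> (u, v) \<in> lazy_step G ^^ n"
  using assms
  by (metis awalk_imp_lazy_relpow gdist_le_length lazy_relpow_imp_awalk obtain_shortest_awalk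
      order_trans)

lemma gdist_eq_0_iff: "u \<in> pverts G \<Longrightarrow> v \<in> pverts G \<Longrightarrow> gdist G u v = 0 \<longleftrightarrow> u = v"
  using gdist_le_iff_relpow[of u v 0] by simp

lemma gdist_commute:
  assumes "u \<in> pverts G" "v \<in> pverts G"
  shows "gdist G u v = gdist G v u"
proof -
  have le: "gdist G b a \<le> gdist G a b" if "a \<in> pverts G" "b \<in> pverts G" for a b
  proof -
    have "(lazy_step G)\<inverse> = lazy_step G"
      using pair_sym_arcs by (auto simp: lazy_step_def symmetric_def elim: symE)
    then have conv: "(lazy_step G ^^ n)\<inverse> = lazy_step G ^^ n" for n
      by (induction n) (simp_all add: converse_relcomp relpow_commute)
    have "(a, b) \<in> lazy_step G ^^ gdist G a b"
      using gdist_le_iff_relpow[OF that] by blast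
    with conv have "(b, a) \<in> lazy_step G ^^ gdist G a b" by blast
    then show ?thesis using gdist_le_iff_relpow that by blast
  qed
  show ?thesis using le[OF assms] le[OF assms(2,1)] by simp
qed

lemma gdist_le_diam: "u \<in> pverts G \<Longrightarrow> v \<in> pverts G \<Longrightarrow> gdist G u v \<le> diam G"
proof -
  have "{gdist G u v | u v. u \<in> pverts G \<and> v \<in> pverts G}
      = (\<lambda>(u, v). gdist G u v) ` (pverts G \<times> pverts G)" by auto
  then have "finite {gdist G u v | u v. u \<in> pverts G \<and> v \<in> pverts G}"
    using pair_finite_verts by simp
  then show "u \<in> pverts G \<Longrightarrow> v \<in> pverts G \<Longrightarrow> gdist G u v \<le> diam G"
    unfolding diam_def by (intro Max_ge) auto
qed

lemma finite_sphere: "finite (sphere G i u)"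
  using pair_finite_verts by (simp add: sphere_def)

lemma sphere_0: "u \<in> pverts G \<Longrightarrow> sphere G 0 u = {u}"
  using gdist_eq_0_iff by (auto simp: sphere_def)

lemma sphere_beyond_diam: "u \<in> pverts G \<Longrightarrow> diam G < i \<Longrightarrow> sphere G i u = {}"
  using gdist_le_diam by (fastforce simp: sphere_def)

end

section \<open>Regularity conditions at all radii\<close>

text \<open>
  For \<open>i = 0\<close> or \<open>j = 0\<close> the identity is the symmetry of the distance, and beyond the diameter
  both sides vanish.
\<close>

lemma (in connected_pair_graph) CDDR_all_radii:
  assumes "CDDR G" and u: "u \<in> pverts G" and v: "v \<in> pverts G"
  shows "card (sphere G i u \<inter> sphere G j v) = card (sphere G i v \<inter> sphere G j u)"
proof -
  consider "i = 0" | "j = 0" | "diam G < i" | "diam G < j" | "i \<in> {1..diam G}" "j \<in> {1..diam G}"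
    by fastforce
  then show ?thesis
  proof cases
    case 1
    have "{u} \<inter> sphere G j v = (if gdist G u v = j then {u} else {})"
      and "{v} \<inter> sphere G j u = (if gdist G u v = j then {v} else {})"
      using u v gdist_commute[OF u v] by (auto simp: sphere_def)
    with 1 u v show ?thesis by (simp add: sphere_0)
  next
    case 2
    have "sphere G i u \<inter> {v} = (if gdist G u v = i then {v} else {})"
      and "sphere G i v \<inter> {u} = (if gdist G u v = i then {u} else {})"
      using u v gdist_commute[OF u v] by (auto simp: sphere_def)
    with 2 u v show ?thesis by (simp add: sphere_0)
  next
    case 5
    with assms show ?thesis unfolding CDDR_def by blast
  qed (simp_all add: sphere_beyond_diam u v)
qed

text \<open>
  The numerator of \<open>mean_intersection\<close>: the number of pairs \<open>(v, w)\<close> with \<open>d(u,v) = h\<close>,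
  \<open>d(u,w) = i\<close> and \<open>d(v,w) = j\<close>.
\<close>

definition triangle_count :: "'a pair_pre_digraph \<Rightarrow> nat \<Rightarrow> nat \<Rightarrow> nat \<Rightarrow> 'a \<Rightarrow> nat" where
  "triangle_count G h i j u = (\<Sum>v\<in>sphere G h u. card (sphere G i u \<inter> sphere G j v))"

lemma mean_intersection_eq:
  "mean_intersection G h i j u = real (triangle_count G h i j u) / real (card (sphere G h u))"
  by (simp add: mean_intersection_def triangle_count_def)

context connected_pair_graph
begin

text \<open>
  For \<open>h = 0\<close> the mean runs over the single vertex \<open>u\<close>, so that with \<open>j = i\<close> it is the size of
  the sphere of radius \<open>i\<close>.
\<close>

lemma DMR_imp_DDR:
  assumes "DMR G"
  shows "DDR G"
  unfolding DDR_def
proof (intro ballI allI)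
  fix u v i assume u: "u \<in> pverts G" and v: "v \<in> pverts G"
  have mean: "mean_intersection G 0 i i w = real (card (sphere G i w))" if "w \<in> pverts G" for w
    using that by (simp add: mean_intersection_def sphere_0)
  show "card (sphere G i u) = card (sphere G i v)"
  proof (cases "i \<le> diam G")
    case True
    with assms u v have "mean_intersection G 0 i i u = mean_intersection G 0 i i v"
      unfolding DMR_def by (meson atLeastAtMost_iff le0)
    with mean u v show ?thesis by simp
  qed (simp add: sphere_beyond_diam u v)
qed

lemma DMR_imp_triangle_count_eq:
  assumes "DMR G" and u: "u \<in> pverts G" and v: "v \<in> pverts G"
  shows "triangle_count G h i j u = triangle_count G h i j v"
proof (cases "h \<le> diam G \<and> i \<le> diam G \<and> j \<le> diam G")
  case True
  have scaled: "real (triangle_count G h i j w)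
      = mean_intersection G h i j w * real (card (sphere G h w))" for w
    using finite_sphere by (simp add: mean_intersection_eq triangle_count_def)
  have "mean_intersection G h i j u = mean_intersection G h i j v"
    using assms True unfolding DMR_def by (meson atLeastAtMost_iff le0)
  moreover have "card (sphere G h u) = card (sphere G h v)"
    using DMR_imp_DDR assms unfolding DDR_def by blast
  ultimately have "real (triangle_count G h i j u) = real (triangle_count G h i j v)"
    by (simp only: scaled)
  then show ?thesis by simp
next
  case False
  have "triangle_count G h i j w = 0" if w: "w \<in> pverts G" for w
  proof -
    have "sphere G j z = {}" if "diam G < j" "z \<in> sphere G h w" for z
      using that sphere_beyond_diam by (auto simp: sphere_def)
    with False show ?thesis
      by (auto simp: triangle_count_def sphere_beyond_diam[OF w] not_le)
  qed
  with u v show ?thesis by simp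
qed

end

section \<open>Spheres of the strong product\<close>

definition max_pairs :: "nat \<Rightarrow> (nat \<times> nat) set" where
  "max_pairs h = {(p, q). max p q = h}"

lemma finite_max_pairs: "finite (max_pairs h)"
  by (rule finite_subset[of _ "{..h} \<times> {..h}"]) (auto simp: max_pairs_def)

lemma sum_sum_sum_mult:
  fixes f :: "'m \<Rightarrow> 'b \<Rightarrow> 'c::comm_semiring_0"
  shows "(\<Sum>b\<in>B. \<Sum>y\<in>Y. \<Sum>m\<in>M. f m b * g m y) = (\<Sum>m\<in>M. (\<Sum>b\<in>B. f m b) * (\<Sum>y\<in>Y. g m y))"
proof -
  have "(\<Sum>b\<in>B. \<Sum>y\<in>Y. \<Sum>m\<in>M. f m b * g m y) = (\<Sum>b\<in>B. \<Sum>m\<in>M. \<Sum>y\<in>Y. f m b * g m y)"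
    by (intro sum.cong refl) (rule sum.swap)
  also have "\<dots> = (\<Sum>m\<in>M. \<Sum>b\<in>B. \<Sum>y\<in>Y. f m b * g m y)"
    by (rule sum.swap)
  finally show ?thesis by (simp add: sum_product)
qed

lemma lazy_step_strong_product:
  assumes "pair_graph G" "pair_graph H"
  shows "((a, x), (b, y)) \<in> lazy_step (G \<boxtimes> H) \<longleftrightarrow> (a, b) \<in> lazy_step G \<and> (x, y) \<in> lazy_step H"
proof -
  interpret G: pair_graph G by fact
  interpret H: pair_graph H by fact
  show ?thesis
    by (auto simp: lazy_step_def strong_product_def dest: G.wellformed' H.wellformed')
qed

lemma lazy_relpow_strong_product:
  assumes "pair_graph G" "pair_graph H"
  shows "((a, x), (b, y)) \<in> lazy_step (G \<boxtimes> H) ^^ n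
    \<longleftrightarrow> (a, b) \<in> lazy_step G ^^ n \<and> (x, y) \<in> lazy_step H ^^ n"
proof (induction n arbitrary: b y)
  case (Suc n)
  then show ?case
    by (auto simp: relcomp_unfold lazy_step_strong_product[OF assms])
qed auto

locale connected_pair_graph_product =
  G: connected_pair_graph G + H: connected_pair_graph H
  for G :: "'a pair_pre_digraph" and H :: "'b pair_pre_digraph"
begin

sublocale GH: connected_pair_graph "G \<boxtimes> H"
  unfolding connected_pair_graph_def connected_pair_graph_axioms_def
  using pair_graph_strong_product connected_strong_product
    G.pair_graph_axioms H.pair_graph_axioms G.connected H.connected by blast

lemma pverts_strong_product: "pverts (G \<boxtimes> H) = pverts G \<times> pverts H"
  by (simp add: strong_product_def)

lemma gdist_strong_product:
  assumes "a \<in> pverts G" "b \<in> pverts G" "x \<in> pverts H" "y \<in> pverts H"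
  shows "gdist (G \<boxtimes> H) (a, x) (b, y) = max (gdist G a b) (gdist H x y)"
proof -
  have le_iff: "gdist (G \<boxtimes> H) (a, x) (b, y) \<le> n \<longleftrightarrow> max (gdist G a b) (gdist H x y) \<le> n" for n
    using assms
    by (simp add: GH.gdist_le_iff_relpow G.gdist_le_iff_relpow H.gdist_le_iff_relpow
        pverts_strong_product
        lazy_relpow_strong_product[OF G.pair_graph_axioms H.pair_graph_axioms])
  show ?thesis by (metis le_iff order_antisym order_refl)
qed

lemma sphere_strong_product:
  assumes "a \<in> pverts G" "x \<in> pverts H"
  shows "sphere (G \<boxtimes> H) h (a, x) = (\<Union>k\<in>max_pairs h. sphere G (fst k) a \<times> sphere H (snd k) x)"
  using assms
  by (auto simp: sphere_def pverts_strong_product gdist_strong_product max_pairs_def)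

lemma sum_sphere_strong_product:
  assumes "a \<in> pverts G" "x \<in> pverts H"
  shows "(\<Sum>z\<in>sphere (G \<boxtimes> H) h (a, x). f z)
    = (\<Sum>(p, q)\<in>max_pairs h. \<Sum>b\<in>sphere G p a. \<Sum>y\<in>sphere H q x. f (b, y))"
proof -
  have "(\<Sum>z\<in>sphere (G \<boxtimes> H) h (a, x). f z)
      = (\<Sum>k\<in>max_pairs h. sum f (sphere G (fst k) a \<times> sphere H (snd k) x))"
    unfolding sphere_strong_product[OF assms]
    by (rule sum.UNION_disjoint)
      (auto simp: finite_max_pairs G.finite_sphere H.finite_sphere sphere_def)
  then show ?thesis
    by (simp add: sum.cartesian_product case_prod_unfold)
qed

lemma card_sphere_strong_product:
  assumes "a \<in> pverts G" "x \<in> pverts H"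
  shows "card (sphere (G \<boxtimes> H) h (a, x))
    = (\<Sum>(p, q)\<in>max_pairs h. card (sphere G p a) * card (sphere H q x))"
  unfolding card_eq_sum sum_sphere_strong_product[OF assms] by (simp add: sum_distrib_left)

lemma card_sphere_Int_strong_product:
  assumes "a \<in> pverts G" "x \<in> pverts H" "b \<in> pverts G" "y \<in> pverts H"
  shows "card (sphere (G \<boxtimes> H) i (a, x) \<inter> sphere (G \<boxtimes> H) j (b, y))
    = (\<Sum>((p, q), (r, s))\<in>max_pairs i \<times> max_pairs j.
        card (sphere G p a \<inter> sphere G r b) * card (sphere H q x \<inter> sphere H s y))"
proof -
  let ?rect = "\<lambda>m. (sphere G (fst (fst m)) a \<inter> sphere G (fst (snd m)) b)
    \<times> (sphere H (snd (fst m)) x \<inter> sphere H (snd (snd m)) y)"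
  have "sphere (G \<boxtimes> H) i (a, x) \<inter> sphere (G \<boxtimes> H) j (b, y)
      = (\<Union>m\<in>max_pairs i \<times> max_pairs j. ?rect m)"
    unfolding sphere_strong_product[OF assms(1,2)] sphere_strong_product[OF assms(3,4)]
    by auto
  also have "card \<dots> = (\<Sum>m\<in>max_pairs i \<times> max_pairs j. card (?rect m))"
    by (rule card_UN_disjoint)
      (auto simp: finite_max_pairs G.finite_sphere H.finite_sphere sphere_def)
  finally show ?thesis
    by (simp add: case_prod_unfold card_cartesian_product)
qed

text \<open>
  For \<open>v = (b, y)\<close> in a fixed rectangle of the sphere of radius \<open>h\<close>, each summand of the
  intersection size is a factor depending on \<open>b\<close> alone times a factor depending on \<open>y\<close> alone,
  so summing over the rectangle sums the two factors separately.
\<close>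

lemma triangle_count_strong_product:
  assumes "a \<in> pverts G" "x \<in> pverts H"
  shows "triangle_count (G \<boxtimes> H) h i j (a, x)
    = (\<Sum>(p, q)\<in>max_pairs h. \<Sum>((r, s), (t, u))\<in>max_pairs i \<times> max_pairs j.
        triangle_count G p r t a * triangle_count H q s u x)"
proof -
  have rect: "(\<Sum>b\<in>sphere G p a. \<Sum>y\<in>sphere H q x.
        card (sphere (G \<boxtimes> H) i (a, x) \<inter> sphere (G \<boxtimes> H) j (b, y)))
      = (\<Sum>((r, s), (t, u))\<in>max_pairs i \<times> max_pairs j.
          triangle_count G p r t a * triangle_count H q s u x)" for p q
  proof -
    let ?cG = "\<lambda>m b. card (sphere G (fst (fst m)) a \<inter> sphere G (fst (snd m)) b)"
    let ?cH = "\<lambda>m y. card (sphere H (snd (fst m)) x \<inter> sphere H (snd (snd m)) y)"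
    have "card (sphere (G \<boxtimes> H) i (a, x) \<inter> sphere (G \<boxtimes> H) j (b, y))
        = (\<Sum>m\<in>max_pairs i \<times> max_pairs j. ?cG m b * ?cH m y)"
      if "b \<in> sphere G p a" "y \<in> sphere H q x" for b y
      using card_sphere_Int_strong_product[OF assms, of b y i j] that
      by (simp add: sphere_def case_prod_unfold)
    then have "(\<Sum>b\<in>sphere G p a. \<Sum>y\<in>sphere H q x.
        card (sphere (G \<boxtimes> H) i (a, x) \<inter> sphere (G \<boxtimes> H) j (b, y)))
      = (\<Sum>b\<in>sphere G p a. \<Sum>y\<in>sphere H q x. \<Sum>m\<in>max_pairs i \<times> max_pairs j. ?cG m b * ?cH m y)"
      by (intro sum.cong refl)
    also have "\<dots> = (\<Sum>m\<in>max_pairs i \<times> max_pairs j.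
        (\<Sum>b\<in>sphere G p a. ?cG m b) * (\<Sum>y\<in>sphere H q x. ?cH m y))"
      by (rule sum_sum_sum_mult)
    finally show ?thesis
      by (simp only: triangle_count_def case_prod_unfold)
  qed
  show ?thesis
    unfolding triangle_count_def[of "G \<boxtimes> H"] sum_sphere_strong_product[OF assms] rect ..
qed

section \<open>Inheritance by the strong product\<close>

lemma DDR_strong_product:
  assumes "DDR G" "DDR H"
  shows "DDR (G \<boxtimes> H)"
  unfolding DDR_def pverts_strong_product
proof (intro ballI allI)
  fix u v i
  assume "u \<in> pverts G \<times> pverts H" "v \<in> pverts G \<times> pverts H"
  then obtain a x b y where uv: "u = (a, x)" "v = (b, y)"
    and mem: "a \<in> pverts G" "x \<in> pverts H" "b \<in> pverts G" "y \<in> pverts H" by auto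
  have "card (sphere G p a) = card (sphere G p b)" "card (sphere H p x) = card (sphere H p y)" for p
    using assms mem unfolding DDR_def by blast+
  then show "card (sphere (G \<boxtimes> H) i u) = card (sphere (G \<boxtimes> H) i v)"
    using mem by (simp add: uv card_sphere_strong_product)
qed

lemma CDDR_strong_product:
  assumes "CDDR G" "CDDR H"
  shows "CDDR (G \<boxtimes> H)"
  unfolding CDDR_def pverts_strong_product
proof (intro ballI)
  fix u v i j
  assume "u \<in> pverts G \<times> pverts H" "v \<in> pverts G \<times> pverts H"
  then obtain a x b y where uv: "u = (a, x)" "v = (b, y)"
    and mem: "a \<in> pverts G" "x \<in> pverts H" "b \<in> pverts G" "y \<in> pverts H" by auto
  have "card (sphere G p a \<inter> sphere G r b) = card (sphere G p b \<inter> sphere G r a)"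
    "card (sphere H p x \<inter> sphere H r y) = card (sphere H p y \<inter> sphere H r x)" for p r
    using assms mem G.CDDR_all_radii H.CDDR_all_radii by blast+
  then show "card (sphere (G \<boxtimes> H) i u \<inter> sphere (G \<boxtimes> H) j v)
      = card (sphere (G \<boxtimes> H) i v \<inter> sphere (G \<boxtimes> H) j u)"
    using mem by (simp add: uv card_sphere_Int_strong_product)
qed

lemma DMR_strong_product:
  assumes "DMR G" "DMR H"
  shows "DMR (G \<boxtimes> H)"
  unfolding DMR_def pverts_strong_product
proof (intro ballI)
  fix h i j u v
  assume mem: "u \<in> pverts G \<times> pverts H" "v \<in> pverts G \<times> pverts H"
  then obtain a x b y where uv: "u = (a, x)" "v = (b, y)"
    and mem': "a \<in> pverts G" "x \<in> pverts H" "b \<in> pverts G" "y \<in> pverts H" by auto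
  have "card (sphere (G \<boxtimes> H) h u) = card (sphere (G \<boxtimes> H) h v)"
    using DDR_strong_product G.DMR_imp_DDR H.DMR_imp_DDR assms mem
    unfolding DDR_def pverts_strong_product by blast
  moreover have "triangle_count G p r t a = triangle_count G p r t b"
    "triangle_count H p r t x = triangle_count H p r t y" for p r t
    using assms mem' G.DMR_imp_triangle_count_eq H.DMR_imp_triangle_count_eq by blast+
  then have "triangle_count (G \<boxtimes> H) h i j u = triangle_count (G \<boxtimes> H) h i j v"
    using mem' by (simp add: uv triangle_count_strong_product)
  ultimately show "mean_intersection (G \<boxtimes> H) h i j u = mean_intersection (G \<boxtimes> H) h i j v"
    by (simp add: mean_intersection_eq)
qed

end

theorem theorem3p4:
  fixes G :: "'a pair_pre_digraph" and H :: "'b pair_pre_digraph"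
  assumes "pair_graph G" and "Digraph_Component.connected (with_proj G)"
    and "pair_graph H" and "Digraph_Component.connected (with_proj H)"
  shows "(DDR G \<and> DDR H \<longrightarrow> DDR (G \<boxtimes> H)) \<and>
         (CDDR G \<and> CDDR H \<longrightarrow> CDDR (G \<boxtimes> H)) \<and>
         (DMR G \<and> DMR H \<longrightarrow> DMR (G \<boxtimes> H))"
proof -
  interpret connected_pair_graph_product G H
    using assms
    by (simp add: connected_pair_graph_product_def connected_pair_graph_def
        connected_pair_graph_axioms_def)
  show ?thesis
    using DDR_strong_product CDDR_strong_product DMR_strong_product by blast
qed

end
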